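(* Let $n\geqslant 1$, let $\tilde c_1,\dots,\tilde c_n\in\mathbb{R}^d$, let $A_1,\dots,A_n\in S_{++}^d$, and let $I_n=\{1,2,\dots,n\}$. Define $\ell$ on the subsets of $I_n$ by $\ell(\varnothing)=-\infty$ and, for non-empty $S\subseteq I_n$, $$\ell(S)=\inf\Big\{r\geqslant 0 : \bigcap_{i\in S}E_r(\tilde c_i,A_i)\neq\emptyset\Big\}.$$ Then $\ell$ is an LP-type function.
   Context: $S_{++}^d$ is the set of real symmetric positive definite $d\times d$ matrices. For $r\geqslant 0$, $E_r(\tilde c,A)=\{x\in\mathbb{R}^d : (x-\tilde c)^\top A(x-\tilde c)\leqslant r^2\}$. Let $S$ be a finite set and $T$ a totally ordered set. A function $\ell\colon 2^S\to T$ is an LP-type function if it satisfies: (1) Monotonicity: if $A\subseteq B\subseteq S$ then $\ell(A)\leqslant\ell(B)\leqslant\ell(S)$. (2) Locality: if $A\subseteq B\subseteq S$, $i\in S$, and $\ell(A)=\ell(B)=\ell(A\cup\{i\})$, then $\ell(B)=\ell(B\cup\{i\})$. Here the ground set is $I_n$ and the totally ordered set is $\mathbb{R}\cup\{-\infty\}$ (with the convention $\ell(S)=\infty$ should the set in the infimum be empty, which in fact never happens). *)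

theory Defs
  imports "HOL-Analysis.Analysis"
begin

definition sym_pos_def :: "(real ^ 'd ^ 'd) set" where
  "sym_pos_def = {A. transpose A = A \<and> (\<forall>x. x \<noteq> 0 \<longrightarrow> x \<bullet> (A *v x) > 0)}"

definition ellipsoid :: "real \<Rightarrow> real ^ 'd \<Rightarrow> real ^ 'd ^ 'd \<Rightarrow> (real ^ 'd) set" where
  "ellipsoid r c A = {x. (x - c) \<bullet> (A *v (x - c)) \<le> r\<^sup>2}"

text \<open>The totally ordered set \<open>T\<close> is a subset of a linearly ordered type, with the induced
  order; \<open>l\<close> is only constrained on the subsets of the ground set \<open>S\<close>.\<close>

definition LP_type_function :: "'i set \<Rightarrow> 't::linorder set \<Rightarrow> ('i set \<Rightarrow> 't) \<Rightarrow> bool" where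
  "LP_type_function S T l \<longleftrightarrow>
     finite S \<and>
     l \<in> Pow S \<rightarrow> T \<and>
     (\<forall>A B. A \<subseteq> B \<and> B \<subseteq> S \<longrightarrow> l A \<le> l B \<and> l B \<le> l S) \<and>
     (\<forall>A B i. A \<subseteq> B \<and> B \<subseteq> S \<and> i \<in> S \<and> l A = l B \<and> l B = l (A \<union> {i})
        \<longrightarrow> l B = l (B \<union> {i}))"

text \<open>The infimum is taken in the extended reals, so it would be \<open>\<infinity>\<close> if no \<open>r\<close> were admissible.\<close>

definition ellipsoid_radius ::
  "(nat \<Rightarrow> real ^ 'd) \<Rightarrow> (nat \<Rightarrow> real ^ 'd ^ 'd) \<Rightarrow> nat set \<Rightarrow> ereal" where
  "ellipsoid_radius c A S =
     (if S = {} then - \<infinity>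
      else Inf {ereal r | r. r \<ge> 0 \<and> (\<Inter>i\<in>S. ellipsoid r (c i) (A i)) \<noteq> {}})"

end

theory Submission
  imports Defs
begin

text \<open>Squaring the radii, \<open>\<ell>(S)\<^sup>2\<close> is the minimum of the pointwise maximum of the quadratic functions
  \<open>(x - c\<^sub>i) \<bullet> A\<^sub>i (x - c\<^sub>i)\<close>. These are coercive, so the minimum is attained, and strictly convex, so
  the minimiser is unique. If \<open>\<ell>(A) = \<ell>(B) = \<ell>(A \<union> {i})\<close> with \<open>A \<subseteq> B\<close>, the minimisers for \<open>B\<close> and for
  \<open>A \<union> {i}\<close> are both minimisers for \<open>A\<close>, hence the same point, which then witnesses
  \<open>\<ell>(B \<union> {i}) \<le> \<ell>(B)\<close>.\<close>

lemma continuous_on_Max_image: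
  fixes f :: "'i \<Rightarrow> 'a::topological_space \<Rightarrow> 'b::linorder_topology"
  assumes "finite S" "S \<noteq> {}" "\<And>i. i \<in> S \<Longrightarrow> continuous_on X (f i)"
  shows "continuous_on X (\<lambda>x. Max ((\<lambda>i. f i x) ` S))"
  using assms
proof (induction S rule: finite_ne_induct)
  case (insert i S)
  have "continuous_on X (\<lambda>x. max (f i x) (Max ((\<lambda>i. f i x) ` S)))"
    using insert by (intro continuous_on_max) auto
  with insert show ?case by simp
qed auto

lemma continuous_on_matrix_quadratic:
  fixes A :: "real ^ 'n ^ 'n"
  assumes "continuous_on X f"
  shows "continuous_on X (\<lambda>x. f x \<bullet> (A *v f x))"
  by (intro continuous_intros assms bounded_linear.continuous_on[OF matrix_vector_mul_bounded_linear])

text \<open>Parallelogram identity: the mixed terms of \<open>u + v\<close> and \<open>u - v\<close>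
  cancel. The subtracted term is positive for positive definite \<open>A\<close> and
  \<open>x \<noteq> y\<close>, so this is strict convexity in quantitative form.\<close>

lemma quadratic_midpoint:
  fixes A :: "real ^ 'n ^ 'n"
  shows "(midpoint x y - c) \<bullet> (A *v (midpoint x y - c)) =
    (x - c) \<bullet> (A *v (x - c)) / 2 + (y - c) \<bullet> (A *v (y - c)) / 2 - (x - y) \<bullet> (A *v (x - y)) / 4"
proof -
  define u v where "u = x - c" and "v = y - c"
  have *: "midpoint x y - c = (1/2) *\<^sub>R (u + v)" "x - y = u - v"
    by (simp_all add: u_def v_def midpoint_def vec_eq_iff field_simps)
  show ?thesis
    unfolding * u_def[symmetric] v_def[symmetric]
    by (simp add: matrix_vector_mult_scaleR matrix_vector_mult_diff_distrib
        matrix_vector_right_distrib inner_add_left inner_add_right inner_diff_left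
        inner_diff_right field_simps)
qed

text \<open>The form attains a positive minimum on the compact unit sphere, and homogeneity carries
  the bound to all vectors. This gives the coercivity behind boundedness of ellipsoids.\<close>

lemma sym_pos_def_lower_bound:
  fixes A :: "real ^ 'n ^ 'n"
  assumes "A \<in> sym_pos_def"
  obtains m where "m > 0" "\<And>v. m * (norm v)\<^sup>2 \<le> v \<bullet> (A *v v)"
proof -
  have "\<exists>u\<in>sphere 0 1. \<forall>v\<in>sphere 0 1. u \<bullet> (A *v u) \<le> v \<bullet> (A *v v)"
    by (intro continuous_attains_inf continuous_on_matrix_quadratic continuous_on_id) auto
  then obtain u :: "real ^ 'n" where u: "norm u = 1"
    and min: "\<And>v. norm v = 1 \<Longrightarrow> u \<bullet> (A *v u) \<le> v \<bullet> (A *v v)"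
    by auto
  show thesis
  proof
    from u have "u \<noteq> 0" by auto
    with assms show "u \<bullet> (A *v u) > 0"
      by (simp add: sym_pos_def_def)
    fix v :: "real ^ 'n"
    show "u \<bullet> (A *v u) * (norm v)\<^sup>2 \<le> v \<bullet> (A *v v)"
    proof (cases "v = 0")
      case False
      \<comment> \<open>Normalising \<open>v\<close> puts it on the sphere and divides the form by
        \<open>(norm v)\<^sup>2\<close>.\<close>
      with min[of "(1 / norm v) *\<^sub>R v"] show ?thesis
        by (simp add: matrix_vector_mult_scaleR field_simps power2_eq_square)
    qed simp
  qed
qed

lemma compact_ellipsoid:
  assumes "A \<in> sym_pos_def"
  shows "compact (ellipsoid r c A)"
proof -
  obtain m where m: "m > 0" "\<And>v. m * (norm v)\<^sup>2 \<le> v \<bullet> (A *v v)"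
    using sym_pos_def_lower_bound[OF assms] by blast
  have "norm (x - c) \<le> sqrt (r\<^sup>2 / m)" if "x \<in> ellipsoid r c A" for x
  proof (rule real_le_rsqrt)
    have "m * (norm (x - c))\<^sup>2 \<le> r\<^sup>2"
      using m(2)[of "x - c"] that by (simp add: ellipsoid_def)
    with m(1) show "(norm (x - c))\<^sup>2 \<le> r\<^sup>2 / m"
      by (simp add: field_simps)
  qed
  then have "bounded (ellipsoid r c A)"
    unfolding bounded_any_center[where a = c] by (metis dist_commute dist_norm)
  moreover have "closed (ellipsoid r c A)"
    unfolding ellipsoid_def
    by (intro closed_Collect_le continuous_on_matrix_quadratic continuous_intros)
  ultimately show ?thesis by (simp add: compact_eq_bounded_closed)
qed

lemma ellipsoid_radius_le:
  assumes "r \<ge> 0" "\<And>i. i \<in> S \<Longrightarrow> x \<in> ellipsoid r (c i) (A i)"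
  shows "ellipsoid_radius c A S \<le> ereal r"
  using assms unfolding ellipsoid_radius_def by (auto intro!: Inf_lower)

text \<open>More indices mean a smaller intersection, hence fewer admissible radii and a larger
  infimum. The value \<open>-\<infinity>\<close> at the empty set lies below everything.\<close>

lemma ellipsoid_radius_mono:
  assumes "S \<subseteq> S'"
  shows "ellipsoid_radius c A S \<le> ellipsoid_radius c A S'"
proof -
  have "(\<Inter>i\<in>S'. ellipsoid r (c i) (A i)) \<subseteq> (\<Inter>i\<in>S. ellipsoid r (c i) (A i))" for r
    using assms by blast
  then have "Inf {ereal r | r. r \<ge> 0 \<and> (\<Inter>i\<in>S. ellipsoid r (c i) (A i)) \<noteq> {}} \<le>
      Inf {ereal r | r. r \<ge> 0 \<and> (\<Inter>i\<in>S'. ellipsoid r (c i) (A i)) \<noteq> {}}"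
    by (intro Inf_superset_mono) blast
  with assms show ?thesis by (auto simp: ellipsoid_radius_def)
qed

text \<open>A radius \<open>r \<ge> 0\<close> is admissible exactly when
  \<open>F y \<le> r\<^sup>2\<close> for some \<open>y\<close>, so a global minimiser of
  \<open>F\<close> is a common point at the optimal radius \<open>sqrt (F x)\<close>.\<close>

lemma ellipsoid_radius_attained:
  assumes "finite S" "S \<noteq> {}" "\<forall>i\<in>S. A i \<in> sym_pos_def"
  obtains r x where "r \<ge> 0" "ellipsoid_radius c A S = ereal r"
    "\<And>i. i \<in> S \<Longrightarrow> x \<in> ellipsoid r (c i) (A i)"
proof -
  define q where "q i x = (x - c i) \<bullet> (A i *v (x - c i))" for i x
  define F where "F x = Max ((\<lambda>i. q i x) ` S)" for x
  have ell: "x \<in> ellipsoid r (c i) (A i) \<longleftrightarrow> q i x \<le> r\<^sup>2" for x r i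
    by (simp add: ellipsoid_def q_def)
  have F_le: "F x \<le> t \<longleftrightarrow> (\<forall>i\<in>S. q i x \<le> t)" for x t
    using assms by (simp add: F_def)
  obtain k where k: "k \<in> S" using assms by blast
  have q_nonneg: "q i x \<ge> 0" if "i \<in> S" for i x
    using bspec[OF assms(3) that] by (cases "x = c i") (auto simp: q_def sym_pos_def_def less_imp_le)
  have q_le_F: "q i x \<le> F x" if "i \<in> S" for i x
    using F_le that by blast
  have F_nonneg: "F x \<ge> 0" for x
    using q_nonneg[OF k] q_le_F[OF k] order_trans by blast
  \<comment> \<open>A compact region on which to minimise \<open>F\<close>: it contains the
    reference point \<open>0\<close>, and outside it already \<open>q k\<close> exceeds
    \<open>F 0\<close>, so a minimiser on \<open>?E\<close> is global.\<close>
  let ?E = "ellipsoid (sqrt (F 0)) (c k) (A k)"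
  have zero: "0 \<in> ?E"
    using q_le_F[OF k] by (simp add: ell F_nonneg)
  have "continuous_on ?E F"
    unfolding F_def q_def using assms(1,2)
    by (intro continuous_on_Max_image continuous_on_matrix_quadratic continuous_intros)
  then obtain x where x: "x \<in> ?E" "\<And>y. y \<in> ?E \<Longrightarrow> F x \<le> F y"
    using continuous_attains_inf[of ?E F] compact_ellipsoid[OF bspec[OF assms(3) k]] zero by blast
  have min: "F x \<le> F y" for y
  proof (cases "y \<in> ?E")
    case False
    then have "F 0 < q k y" by (simp add: ell F_nonneg)
    with x(2)[OF zero] q_le_F[OF k, of y] show ?thesis by linarith
  qed (use x in blast)
  show thesis
  proof
    show "sqrt (F x) \<ge> 0" by (simp add: F_nonneg)
    show in_E: "x \<in> ellipsoid (sqrt (F x)) (c i) (A i)" if "i \<in> S" for i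
      using q_le_F[OF that] by (simp add: ell F_nonneg)
    \<comment> \<open>A common point \<open>y\<close> at radius \<open>r\<close> gives
      \<open>F x \<le> F y \<le> r\<^sup>2\<close>.\<close>
    have "ereal (sqrt (F x)) \<le> ereal r" if "r \<ge> 0" "y \<in> (\<Inter>i\<in>S. ellipsoid r (c i) (A i))" for r y
      unfolding ereal_less_eq
    proof (rule real_le_lsqrt)
      show "F x \<le> r\<^sup>2"
        using that min[of y] F_le[of y "r\<^sup>2"] by (auto simp: ell)
    qed (use that F_nonneg in auto)
    then have "ereal (sqrt (F x)) \<le>
        Inf {ereal r | r. r \<ge> 0 \<and> (\<Inter>i\<in>S. ellipsoid r (c i) (A i)) \<noteq> {}}"
      by (intro Inf_greatest) blast
    then have "ereal (sqrt (F x)) \<le> ellipsoid_radius c A S"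
      using assms(2) by (simp add: ellipsoid_radius_def)
    moreover have "ellipsoid_radius c A S \<le> ereal (sqrt (F x))"
      by (rule ellipsoid_radius_le[where x = x]) (auto simp: F_nonneg in_E)
    ultimately show "ellipsoid_radius c A S = ereal (sqrt (F x))" by simp
  qed
qed

text \<open>By strict convexity, the midpoint of two distinct optimal points would lie strictly
  inside every ellipsoid, and hence in all of them at a smaller radius.\<close>

lemma ellipsoid_radius_center_unique:
  assumes "finite S" "S \<noteq> {}" "\<forall>i\<in>S. A i \<in> sym_pos_def"
    and r: "ellipsoid_radius c A S = ereal r"
    and x: "\<And>i. i \<in> S \<Longrightarrow> x \<in> ellipsoid r (c i) (A i)"
    and y: "\<And>i. i \<in> S \<Longrightarrow> y \<in> ellipsoid r (c i) (A i)"
  shows "x = y"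
proof (rule ccontr)
  assume "x \<noteq> y"
  define z where "z = midpoint x y"
  define q where "q i = (z - c i) \<bullet> (A i *v (z - c i))" for i
  define F where "F = Max (q ` S)"
  \<comment> \<open>The ellipsoids only see \<open>r\<^sup>2\<close>; the sign of \<open>r\<close>
    comes from attainment and is used to pass from \<open>F < r\<^sup>2\<close> to
    \<open>sqrt F < r\<close>.\<close>
  obtain r' where "r' \<ge> 0" "ellipsoid_radius c A S = ereal r'"
    using ellipsoid_radius_attained[OF assms(1-3), where c = c] by blast
  with r have "r \<ge> 0" by simp
  have "q i < r\<^sup>2" if "i \<in> S" for i
  proof -
    have "(x - y) \<bullet> (A i *v (x - y)) > 0"
      using bspec[OF assms(3) that] \<open>x \<noteq> y\<close> by (simp add: sym_pos_def_def)
    with x[OF that] y[OF that] show ?thesis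
      unfolding q_def z_def quadratic_midpoint ellipsoid_def mem_Collect_eq by linarith
  qed
  \<comment> \<open>Finiteness of \<open>S\<close> turns the separate strict inequalities into one
    uniform gap.\<close>
  then have "F < r\<^sup>2" using assms(1,2) by (simp add: F_def)
  have q_le: "q i \<le> F" if "i \<in> S" for i
    using that assms(1) by (simp add: F_def)
  have q_nonneg: "q i \<ge> 0" if "i \<in> S" for i
    using bspec[OF assms(3) that] by (cases "z = c i") (auto simp: q_def sym_pos_def_def less_imp_le)
  have "F \<ge> 0" using q_le q_nonneg assms(2) by (meson all_not_in_conv order_trans)
  then have "ellipsoid_radius c A S \<le> ereal (sqrt F)"
    using q_le by (intro ellipsoid_radius_le[where x = z]) (auto simp: ellipsoid_def q_def)
  moreover have "sqrt F < r"
    using \<open>F < r\<^sup>2\<close> \<open>r \<ge> 0\<close> by (simp add: real_less_lsqrt)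
  ultimately show False using r by simp
qed

lemma ellipsoid_radius_locality:
  assumes "finite B" "S \<subseteq> B" "\<forall>j\<in>insert i B. A j \<in> sym_pos_def"
    and eq: "ellipsoid_radius c A S = ellipsoid_radius c A B"
      "ellipsoid_radius c A B = ellipsoid_radius c A (insert i S)"
  shows "ellipsoid_radius c A B = ellipsoid_radius c A (insert i B)"
proof -
  have fin: "finite S" "finite (insert i S)"
    using assms(1,2) finite_subset by auto
  have pd: "\<forall>j\<in>S. A j \<in> sym_pos_def" "\<forall>j\<in>B. A j \<in> sym_pos_def"
    "\<forall>j\<in>insert i S. A j \<in> sym_pos_def"
    using assms(2,3) by blast+
  obtain r y where r: "r \<ge> 0" "ellipsoid_radius c A (insert i S) = ereal r"
    and y: "\<And>j. j \<in> insert i S \<Longrightarrow> y \<in> ellipsoid r (c j) (A j)"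
    using ellipsoid_radius_attained[OF fin(2) insert_not_empty pd(3), where c = c] by blast
  \<comment> \<open>An empty \<open>S\<close> would have value \<open>-\<infinity>\<close>, whereas
    the equal value at \<open>insert i S\<close> is real.\<close>
  have ne: "S \<noteq> {}"
    using eq r by (auto simp: ellipsoid_radius_def)
  then have "B \<noteq> {}" using assms(2) by auto
  obtain r' x where r': "ellipsoid_radius c A B = ereal r'"
    and x: "\<And>j. j \<in> B \<Longrightarrow> x \<in> ellipsoid r' (c j) (A j)"
    using ellipsoid_radius_attained[OF assms(1) \<open>B \<noteq> {}\<close> pd(2), where c = c] by blast
  have "r' = r" using r' eq r by simp
  \<comment> \<open>Both points are optimal for \<open>S\<close>: \<open>x\<close> comes from
    \<open>B\<close> and \<open>y\<close> from \<open>insert i S\<close>. Their equality puts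
    \<open>x\<close> in the \<open>i\<close>-th ellipsoid as well.\<close>
  have "x = y"
    by (rule ellipsoid_radius_center_unique[OF fin(1) ne pd(1), of c r])
      (use eq r x y assms(2) \<open>r' = r\<close> in auto)
  then have "ellipsoid_radius c A (insert i B) \<le> ereal r"
    using r x y \<open>r' = r\<close> by (intro ellipsoid_radius_le[where x = x]) auto
  moreover have "ellipsoid_radius c A B \<le> ellipsoid_radius c A (insert i B)"
    by (intro ellipsoid_radius_mono) auto
  ultimately show ?thesis using eq r by simp
qed

theorem theorem2p17:
  fixes n :: nat
    and c :: "nat \<Rightarrow> real ^ 'd"
    and A :: "nat \<Rightarrow> real ^ 'd ^ 'd"
  assumes "n \<ge> 1"
    and "\<And>i. i \<in> {1..n} \<Longrightarrow> A i \<in> sym_pos_def"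
  shows "LP_type_function {1..n} {t :: ereal. t \<noteq> \<infinity>} (ellipsoid_radius c A)"
  unfolding LP_type_function_def
proof (intro conjI allI impI)
  show "ellipsoid_radius c A \<in> Pow {1..n} \<rightarrow> {t. t \<noteq> \<infinity>}"
  proof (intro funcsetI CollectI)
    fix S assume S: "S \<in> Pow {1..n}"
    show "ellipsoid_radius c A S \<noteq> \<infinity>"
    proof (cases "S = {}")
      case False
      have "finite S" "\<forall>i\<in>S. A i \<in> sym_pos_def"
        using S assms(2) by (auto intro: finite_subset)
      then obtain r where "ellipsoid_radius c A S = ereal r"
        using ellipsoid_radius_attained[of S A c] False by blast
      then show ?thesis by simp
    qed (simp add: ellipsoid_radius_def)
  qed
next
  fix S B i
  assume *: "S \<subseteq> B \<and> B \<subseteq> {1..n} \<and> i \<in> {1..n} \<and>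
    ellipsoid_radius c A S = ellipsoid_radius c A B \<and>
    ellipsoid_radius c A B = ellipsoid_radius c A (S \<union> {i})"
  then have "finite B" "\<forall>j\<in>insert i B. A j \<in> sym_pos_def"
    using assms(2) by (blast intro: finite_subset)+
  with * show "ellipsoid_radius c A B = ellipsoid_radius c A (B \<union> {i})"
    using ellipsoid_radius_locality[of B S i A c] by simp
\<comment> \<open>What remains is finiteness of the ground set and the two monotonicity
  inequalities.\<close>
qed (auto intro: ellipsoid_radius_mono)

end
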